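(* (Commutativity of reductions.) Let $G\in\mathbb{G}_\pi$ and suppose the sequences $S_1,\dots,S_m$ and $T_1,\dots,T_n$ both induce a sequence of reductions on $G$. If $S_m=T_n$, then $\mathcal{R}(G;S_1,\dots,S_m)=\mathcal{R}(G;T_1,\dots,T_n)$.
   Context: $\mathbb{W}$ is the field of complex rational functions $p/q$ in $\lambda$ ($p,q\in\mathbb{C}[\lambda]$, $q\ne0$, lowest terms). $\mathbb{G}$ is the class of finite weighted digraphs $G=(V,E,\omega)$, no parallel edges, loops allowed, $\omega:E\to\mathbb{W}$, $\omega(e)=0$ iff $e\notin E$; $M(G)_{ij}=\omega(v_i,v_j)$. For $w=p/q\in\mathbb{W}$, $\pi(w)=\deg p-\deg q$ (with $\deg 0=-\infty$); $\mathbb{G}_\pi$ is the set of $G\in\mathbb{G}$ with $\pi(M(G)_{ij})\le 0$ for all $i,j$. Paths/cycles: sequences of distinct vertices joined by consecutive edges (cycles: first vertex = last; loops are cycles); interior vertices are all but first and last. A structural set of $G$ is a nonempty $S\subseteq V$ such that $V\setminus S$ induces no cycles in $G$ with loops removed and $\omega(v_i,v_i)\ne\lambda$ for all $v_i\notin S$; $st(G)$ is their set. $\mathcal{B}_{ij}(G;S)$: paths or cycles from $v_i\in S$ to $v_j\in S$ with no interior vertex in $S$. Branch product of $\beta=u_1,\dots,u_k$: $\omega(u_1,u_2)\prod_{t=2}^{k-1}\omega(u_t,u_{t+1})/(\lambda-\omega(u_t,u_t))$ ($=\omega(u_1,u_2)$ if $k=2$). $\mathcal{R}_S(G)$: weighted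 digraph on vertex set $S$ with edge $(v_i,v_j)$ iff $\mathcal{B}_{ij}(G;S)\ne\emptyset$, weighted by the sum of the branch products over $\mathcal{B}_{ij}(G;S)$. $S_1,\dots,S_m\subseteq V$ induce a sequence of reductions on $G$ if $S_1\in st(G)$ and, with $\mathcal{R}_1(G)=\mathcal{R}_{S_1}(G)$, for $1\le i\le m-1$: $S_{i+1}\in st(\mathcal{R}_i(G))$ and $\mathcal{R}_{i+1}(G)=\mathcal{R}_{S_{i+1}}(\mathcal{R}_i(G))$; then $\mathcal{R}(G;S_1,\dots,S_i)=\mathcal{R}_i(G)$. Equality of graphs means same vertex set, same edges and same weights. *)

theory Defs
  imports
    "HOL-Library.Extended_Real"
    "HOL-Computational_Algebra.Computational_Algebra"
    "HOL-Computational_Algebra.Field_as_Ring"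
    "Graph_Theory.Graph_Theory"
begin

type_synonym ratfun = "complex poly fract"

definition lam :: ratfun where
  "lam = Fraction_Field.Fract [:0, 1:] 1"

text \<open>\<^const>\<open>quot_of_fract\<close> returns numerator and (nonzero, monic) denominator
  in lowest terms.\<close>

definition rat_deg :: "ratfun \<Rightarrow> ereal" where
  "rat_deg w = (if w = 0 then -\<infinity>
     else ereal (real (degree (fst (quot_of_fract w))) - real (degree (snd (quot_of_fract w)))))"

text \<open>The weight is a total function; it vanishes off the arcs, so that equality of
  records is equality of vertex sets, arcs and weights. In a reduction an arc may also carry
  weight 0 (when its branch products cancel), hence the arcs are recorded separately and the
  condition that arcs have nonzero weight belongs to \<open>weighted_digraph\<close> only.\<close>

record 'a wdigraph =
  skel :: "'a pair_pre_digraph"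
  weight :: "'a \<Rightarrow> 'a \<Rightarrow> ratfun"

definition weighted_digraph :: "'a wdigraph \<Rightarrow> bool" where
  "weighted_digraph G \<longleftrightarrow> pair_fin_digraph (skel G) \<and>
     (\<forall>u v. weight G u v = 0 \<longleftrightarrow> (u, v) \<notin> parcs (skel G))"

definition weighted_digraph_pi :: "'a wdigraph \<Rightarrow> bool" where
  "weighted_digraph_pi G \<longleftrightarrow> weighted_digraph G \<and>
     (\<forall>u \<in> pverts (skel G). \<forall>v \<in> pverts (skel G). rat_deg (weight G u v) \<le> 0)"

text \<open>Paths and cycles are vertex sequences with at least one arc; a loop at \<open>v\<close> is the
  cycle \<open>[v, v]\<close>.\<close>

definition is_path :: "('a, 'b) pre_digraph \<Rightarrow> 'a list \<Rightarrow> bool" where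
  "is_path D p \<longleftrightarrow> vpath p D \<and> 2 \<le> length p"

definition is_cycle :: "('a, 'b) pre_digraph \<Rightarrow> 'a list \<Rightarrow> bool" where
  "is_cycle D p \<longleftrightarrow> vwalk p D \<and> 2 \<le> length p \<and> hd p = last p \<and> distinct (tl p)"

definition interior_verts :: "'a list \<Rightarrow> 'a set" where
  "interior_verts p = set (butlast (tl p))"

definition del_loops :: "'a pair_pre_digraph \<Rightarrow> 'a pair_pre_digraph" where
  "del_loops D = \<lparr>pverts = pverts D, parcs = {(u, v) \<in> parcs D. u \<noteq> v}\<rparr>"

definition st :: "'a wdigraph \<Rightarrow> 'a set set" where
  "st G = {S. S \<noteq> {} \<and> S \<subseteq> pverts (skel G) \<and>
     (\<nexists>p. is_cycle (with_proj (del_loops (skel G)) \<restriction> (pverts (skel G) - S)) p) \<and>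
     (\<forall>v \<in> pverts (skel G) - S. weight G v v \<noteq> lam)}"

definition branches :: "'a wdigraph \<Rightarrow> 'a set \<Rightarrow> 'a \<Rightarrow> 'a \<Rightarrow> 'a list set" where
  "branches G S i j = {p.
     (is_path (with_proj (skel G)) p \<or> is_cycle (with_proj (skel G)) p) \<and>
     hd p = i \<and> last p = j \<and> i \<in> S \<and> j \<in> S \<and> interior_verts p \<inter> S = {}}"

text \<open>Lists are indexed from 0: the interior vertices are \<open>p ! t\<close> with
  \<open>1 \<le> t < length p - 1\<close>.\<close>

definition branch_product :: "'a wdigraph \<Rightarrow> 'a list \<Rightarrow> ratfun" where
  "branch_product G p = weight G (p ! 0) (p ! 1) *
     (\<Prod>t = 1..<length p - 1. weight G (p ! t) (p ! (t + 1)) / (lam - weight G (p ! t) (p ! t)))"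

definition reduction :: "'a set \<Rightarrow> 'a wdigraph \<Rightarrow> 'a wdigraph" where
  "reduction S G = \<lparr>
     skel = \<lparr>pverts = S, parcs = {(i, j). branches G S i j \<noteq> {}}\<rparr>,
     weight = (\<lambda>i j. \<Sum>p \<in> branches G S i j. branch_product G p)\<rparr>"

definition reductions :: "'a wdigraph \<Rightarrow> 'a set list \<Rightarrow> 'a wdigraph" where
  "reductions G Ss = fold reduction Ss G"

definition induces_reductions :: "'a wdigraph \<Rightarrow> 'a set list \<Rightarrow> bool" where
  "induces_reductions G Ss \<longleftrightarrow>
     Ss \<noteq> [] \<and> (\<forall>i < length Ss. Ss ! i \<in> st (reductions G (take i Ss)))"

end

theory Submission
  imports Defs
begin

text \<open>
  The weight matrix \<open>R\<close> of \<open>\<R>\<^sub>S(G)\<close> is determined by a partial eigenvector problem for the weight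
  matrix \<open>A\<close> of \<open>G\<close>: every vector on \<open>S\<close> extends to a vector \<open>x\<close> on \<open>V\<close> satisfying
  \<open>A x = \<lambda> x\<close> at the vertices off \<open>S\<close>, and for every such \<open>x\<close> the vectors \<open>R x\<close> and \<open>A x\<close> agree
  on \<open>S\<close>. (So \<open>R - \<lambda>\<close> is a Schur complement of \<open>A - \<lambda>\<close>.) Similarly \<open>(i, j)\<close> is an arc of
  \<open>\<R>\<^sub>S(G)\<close> iff \<open>j\<close> can be reached from \<open>i\<close> by a nonempty walk of \<open>G\<close> with interior off \<open>S\<close>.
  Both properties are transitive under successive reductions and pin down the reduced graph, so
  the result depends only on the last vertex set. A branch is handled as its first vertex
  followed by a path that leaves \<open>V \<setminus> S\<close> only at its end.
\<close>

section \<open>Walks avoiding a vertex set\<close>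

text \<open>Only the tail is restricted, so a walk along these arcs may end in \<open>S\<close> but
  cannot continue from there.\<close>

definition arcs_off :: "'a set \<Rightarrow> 'a rel \<Rightarrow> 'a rel" where
  "arcs_off S E = {(u, v) \<in> E. u \<notin> S}"

definition through_arcs :: "'a set \<Rightarrow> 'a rel \<Rightarrow> 'a rel" where
  "through_arcs S E = (E O (arcs_off S E)\<^sup>*) \<inter> S \<times> S"

lemma arcs_off_antimono: "T \<subseteq> S \<Longrightarrow> arcs_off S E \<subseteq> arcs_off T E"
  by (auto simp: arcs_off_def)

text \<open>From left to right, each intermediate arc expands into a walk of \<open>E\<close>, whose
  vertices off \<open>S\<close> are also off \<open>T\<close>. From right to left, a walk of
  \<open>E\<close> is cut at its visits to \<open>S\<close>.\<close>

lemma through_arcs_trans: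
  assumes "T \<subseteq> S"
  shows "through_arcs T (through_arcs S E) = through_arcs T E"
proof -
  let ?F = "through_arcs S E"
  have off: "(arcs_off S E)\<^sup>* \<subseteq> (arcs_off T E)\<^sup>*"
    by (rule rtrancl_mono[OF arcs_off_antimono[OF assms]])
  have "arcs_off T ?F \<subseteq> (arcs_off T E)\<^sup>*"
  proof clarify
    fix a b assume "(a, b) \<in> arcs_off T ?F"
    then obtain c where "(a, c) \<in> arcs_off T E" "(c, b) \<in> (arcs_off S E)\<^sup>*"
      by (auto simp: arcs_off_def through_arcs_def)
    with off show "(a, b) \<in> (arcs_off T E)\<^sup>*" by (meson converse_rtrancl_into_rtrancl subsetD)
  qed
  then have sub: "(arcs_off T ?F)\<^sup>* \<subseteq> (arcs_off T E)\<^sup>*"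
    by (metis rtrancl_idemp rtrancl_mono)
  have "through_arcs T ?F \<subseteq> through_arcs T E"
  proof clarify
    fix i j assume "(i, j) \<in> through_arcs T ?F"
    then obtain u where "(i, u) \<in> ?F" "(u, j) \<in> (arcs_off T ?F)\<^sup>*" "i \<in> T" "j \<in> T"
      by (auto simp: through_arcs_def)
    then obtain c where "(i, c) \<in> E" "(c, u) \<in> (arcs_off T E)\<^sup>*" "(u, j) \<in> (arcs_off T E)\<^sup>*"
      using sub off by (auto simp: through_arcs_def)
    with \<open>i \<in> T\<close> \<open>j \<in> T\<close> show "(i, j) \<in> through_arcs T E"
      by (auto simp: through_arcs_def intro: rtrancl_trans)
  qed
  moreover have "through_arcs T E \<subseteq> through_arcs T ?F"
  proof clarify
    fix i j assume "(i, j) \<in> through_arcs T E"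
    then obtain u where iu: "(i, u) \<in> E" and uj: "(u, j) \<in> (arcs_off T E)\<^sup>*"
      and ij: "i \<in> T" "j \<in> T"
      by (auto simp: through_arcs_def)
    \<comment> \<open>Here \<open>w\<close> is the first vertex of \<open>S\<close> on the walk from
      \<open>u\<close>, and the rest of the walk is already cut into arcs of \<open>?F\<close>.
      Prepending a vertex of \<open>S\<close> makes that vertex the new \<open>w\<close>.\<close>
    from uj have "\<exists>w\<in>S. (u, w) \<in> (arcs_off S E)\<^sup>* \<and> (w, j) \<in> (arcs_off T ?F)\<^sup>*"
    proof (induction rule: converse_rtrancl_induct)
      case base
      then show ?case using ij assms by blast
    next
      case (step a b)
      then obtain w where w: "w \<in> S" "(b, w) \<in> (arcs_off S E)\<^sup>*" "(w, j) \<in> (arcs_off T ?F)\<^sup>*"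
        by blast
      show ?case
      proof (cases "a \<in> S")
        case True
        with step.hyps w have "(a, w) \<in> arcs_off T ?F"
          by (auto simp: arcs_off_def through_arcs_def)
        with w True show ?thesis by (meson converse_rtrancl_into_rtrancl rtrancl.rtrancl_refl)
      next
        case False
        with step.hyps have "(a, b) \<in> arcs_off S E" by (auto simp: arcs_off_def)
        with w show ?thesis by (meson converse_rtrancl_into_rtrancl)
      qed
    qed
    then obtain w where "w \<in> S" "(u, w) \<in> (arcs_off S E)\<^sup>*" "(w, j) \<in> (arcs_off T ?F)\<^sup>*"
      by blast
    with iu ij assms show "(i, j) \<in> through_arcs T ?F"
      by (auto simp: through_arcs_def)
  qed
  ultimately show ?thesis by blast
qed

section \<open>Simple paths and cycles from reachability\<close>

lemma in_set_butlast_or_last: "x \<in> set xs \<Longrightarrow> x \<in> set (butlast xs) \<or> x = last xs"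
  by (cases xs rule: rev_cases) auto

lemma vwalk_arcs_dropWhile: "set (vwalk_arcs (dropWhile P p)) \<subseteq> set (vwalk_arcs p)"
  by (induction p rule: vwalk_arcs.induct) (auto split: if_splits)

lemma fst_vwalk_arcs: "map fst (vwalk_arcs p) = butlast p"
  by (induction p rule: vwalk_arcs.induct) auto

text \<open>Loop erasure: if the vertex to be prepended already lies on the path, the part before
  its occurrence is dropped instead.\<close>

lemma rtrancl_imp_path:
  assumes "(u, v) \<in> r\<^sup>*"
  shows "\<exists>p. p \<noteq> [] \<and> hd p = u \<and> last p = v \<and> distinct p \<and> set (vwalk_arcs p) \<subseteq> r"
  using assms
proof (induction rule: converse_rtrancl_induct)
  case base
  show ?case by (rule exI[of _ "[v]"]) simp
next
  case (step a b)
  then obtain p where p: "p \<noteq> []" "hd p = b" "last p = v" "distinct p" "set (vwalk_arcs p) \<subseteq> r"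
    by blast
  show ?case
  proof (cases "a \<in> set p")
    case True
    let ?q = "dropWhile (\<lambda>y. y \<noteq> a) p"
    have ne: "?q \<noteq> []" using True by auto
    have "hd ?q = a" using hd_dropWhile[OF ne] by simp
    moreover have "last ?q = v"
      using p(3) ne by (metis append.right_neutral last_appendR takeWhile_dropWhile_id)
    moreover have "set (vwalk_arcs ?q) \<subseteq> r"
      using vwalk_arcs_dropWhile p(5) by fast
    ultimately show ?thesis using ne p(4) distinct_dropWhile by blast
  next
    case False
    with p step.hyps show ?thesis by (intro exI[of _ "a # p"]) auto
  qed
qed

lemma path_imp_rtrancl:
  "p \<noteq> [] \<Longrightarrow> set (vwalk_arcs p) \<subseteq> r \<Longrightarrow> v \<in> set p \<Longrightarrow> (hd p, v) \<in> r\<^sup>*"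
proof (induction p)
  case (Cons a p)
  then show ?case
    by (cases "p = []") (auto intro: converse_rtrancl_into_rtrancl)
qed simp

lemma vwalk_arcs_subset: "set (vwalk_arcs p) \<subseteq> set p \<times> set p"
  by (induction p rule: vwalk_arcs.induct) auto

text \<open>A closed walk is its first arc followed by a way back; loop erasure of the way back
  leaves a cycle.\<close>

lemma acyclic_if_no_cycle:
  assumes "\<nexists>p. is_cycle D p" and "arcs_ends D \<subseteq> verts D \<times> verts D"
  shows "acyclic (arcs_ends D)"
proof (rule acyclicI, intro allI notI)
  fix v assume "(v, v) \<in> (arcs_ends D)\<^sup>+"
  then obtain u where vu: "(v, u) \<in> arcs_ends D" and "(u, v) \<in> (arcs_ends D)\<^sup>*"
    by (meson tranclD)
  from rtrancl_imp_path[OF this(2)] obtain p where p: "p \<noteq> []" "hd p = u" "last p = v"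
    "distinct p" "set (vwalk_arcs p) \<subseteq> arcs_ends D" by blast
  have "set p \<subseteq> verts D"
  proof
    fix w assume "w \<in> set p"
    then have "w = u \<or> (u, w) \<in> (arcs_ends D)\<^sup>+"
      using path_imp_rtrancl[OF p(1,5)] p(2) by (metis rtranclD)
    then show "w \<in> verts D"
      using vu assms(2) by (meson mem_Sigma_iff subsetD tranclD2)
  qed
  then have "is_cycle D (v # p)"
    using p vu assms(2) by (cases p) (auto simp: is_cycle_def vwalk_def)
  with assms(1) show False by blast
qed

section \<open>Branches\<close>

definition exit_paths :: "'a wdigraph \<Rightarrow> 'a set \<Rightarrow> 'a \<Rightarrow> 'a list set" where
  "exit_paths G S v = {q. q \<noteq> [] \<and> hd q = v \<and> last q \<in> S \<and> set (butlast q) \<inter> S = {} \<and>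
     distinct q \<and> set (vwalk_arcs q) \<subseteq> parcs (skel G)}"

definition exit_product :: "'a wdigraph \<Rightarrow> 'a list \<Rightarrow> ratfun" where
  "exit_product G q =
     (\<Prod>t<length q - 1. weight G (q ! t) (q ! Suc t) / (lam - weight G (q ! t) (q ! t)))"

lemma exit_product_singleton [simp]: "exit_product G [v] = 1"
  by (simp add: exit_product_def)

lemma exit_product_Cons:
  assumes "q \<noteq> []"
  shows "exit_product G (v # q) = weight G v (hd q) / (lam - weight G v v) * exit_product G q"
proof -
  obtain n where n: "length q = Suc n" using assms by (cases q) auto
  then show ?thesis
    using assms by (simp add: exit_product_def prod.lessThan_Suc_shift hd_conv_nth del: prod.lessThan_Suc)
qed

lemma branch_product_Cons:
  assumes "q \<noteq> []"
  shows "branch_product G (i # q) = weight G i (hd q) * exit_product G q"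
proof -
  obtain n where n: "length q = Suc n" using assms by (cases q) auto
  \<comment> \<open>Position \<open>t + 1\<close> of the branch is position \<open>t\<close> of
    \<open>q\<close>, so the interior of the branch is all of \<open>q\<close> but its end.\<close>
  have "{1..<Suc n} = Suc ` {..<n}"
    by (simp add: lessThan_atLeast0)
  then show ?thesis
    using assms n by (simp add: branch_product_def exit_product_def hd_conv_nth prod.reindex)
qed

text \<open>The part of \<open>weighted_digraph\<close> that survives a reduction: branch products
  may cancel, so an arc may have weight 0, but a missing arc always has.\<close>

definition supported :: "'a wdigraph \<Rightarrow> bool" where
  "supported G \<longleftrightarrow> finite (pverts (skel G)) \<and> parcs (skel G) \<subseteq> pverts (skel G) \<times> pverts (skel G) \<and>
     (\<forall>u v. (u, v) \<notin> parcs (skel G) \<longrightarrow> weight G u v = 0)"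

lemma exit_paths_subset_verts:
  assumes "supported G" and "S \<subseteq> pverts (skel G)" and "q \<in> exit_paths G S v"
  shows "set q \<subseteq> pverts (skel G)"
proof -
  have "set (butlast q) \<subseteq> fst ` set (vwalk_arcs q)"
    unfolding fst_vwalk_arcs[symmetric] by simp
  also have "\<dots> \<subseteq> pverts (skel G)"
    using assms by (auto simp: exit_paths_def supported_def)
  finally have "set (butlast q) \<subseteq> pverts (skel G)" .
  moreover have "q = butlast q @ [last q]" "last q \<in> S" using assms(3) by (auto simp: exit_paths_def)
  ultimately show ?thesis
    using assms(2) by (metis Un_subset_iff empty_set empty_subsetI insert_subset list.simps(15) set_append subsetD)
qed

lemma finite_exit_paths:
  assumes "supported G" and "S \<subseteq> pverts (skel G)"
  shows "finite (exit_paths G S v)"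
proof (rule finite_subset)
  show "exit_paths G S v \<subseteq> {q. set q \<subseteq> pverts (skel G) \<and> distinct q}"
    using exit_paths_subset_verts[OF assms] by (auto simp: exit_paths_def)
  show "finite {q. set q \<subseteq> pverts (skel G) \<and> distinct q}"
    using finite_subset_distinct assms(1) by (auto simp: supported_def)
qed

lemma exit_paths_of_exit:
  assumes "v \<in> S"
  shows "exit_paths G S v = {[v]}"
proof -
  have "q = [v]" if "q \<in> exit_paths G S v" for q
    using that assms by (cases q) (auto simp: exit_paths_def split: if_splits)
  then show ?thesis using assms by (auto simp: exit_paths_def)
qed

text \<open>A cycle repeats its first vertex only at the end, so that both kinds of branch have
  distinct vertices after the first one; whether the branch is a cycle is decided by \<open>i = j\<close>.\<close>

lemma branches_eq:
  assumes "supported G" and S: "S \<subseteq> pverts (skel G)" and "i \<in> S" "j \<in> S"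
  shows "branches G S i j =
    {i # q |q. (i, hd q) \<in> parcs (skel G) \<and> q \<in> exit_paths G S (hd q) \<and> last q = j}"
    (is "_ = ?R")
proof (intro set_eqI iffI)
  fix p assume p: "p \<in> branches G S i j"
  then obtain u q' where "p = i # u # q'"
    by (cases p; cases "tl p") (auto simp: branches_def is_path_def is_cycle_def)
  with p assms show "p \<in> ?R"
    by (auto simp: branches_def is_path_def is_cycle_def exit_paths_def interior_verts_def
        vpath_def vwalk_def)
next
  fix p assume "p \<in> ?R"
  then obtain q where q: "p = i # q" "(i, hd q) \<in> parcs (skel G)" "q \<in> exit_paths G S (hd q)"
    "last q = j" by blast
  have ne: "q \<noteq> []" using q by (auto simp: exit_paths_def)
  have w: "vwalk p (with_proj (skel G))"
    using exit_paths_subset_verts[OF assms(1,2) q(3)] q assms ne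
    by (auto simp: vwalk_def exit_paths_def)
  have "is_path (with_proj (skel G)) p \<or> is_cycle (with_proj (skel G)) p"
  proof (cases "i \<in> set q")
    case True
    \<comment> \<open>All vertices of \<open>q\<close> before its end avoid \<open>S\<close>, so
      \<open>i\<close> can recur only at the end, where it closes a cycle.\<close>
    then have "i = last q"
      using in_set_butlast_or_last q(3) \<open>i \<in> S\<close> by (fastforce simp: exit_paths_def)
    with w q ne show ?thesis by (cases q) (auto simp: is_cycle_def exit_paths_def)
  next
    case False
    with w q ne show ?thesis by (cases q) (auto simp: is_path_def vpath_def exit_paths_def)
  qed
  with q ne assms(3,4) show "p \<in> branches G S i j"
    by (auto simp: branches_def interior_verts_def exit_paths_def)
qed

text \<open>Loop erasure turns a walk with all tails off \<open>S\<close> into an exit path with the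
  same ends. Conversely, the tails along an exit path are its \<open>butlast\<close>, which avoids
  \<open>S\<close>.\<close>

lemma arcs_reduction:
  assumes "supported G" and S: "S \<subseteq> pverts (skel G)"
  shows "parcs (skel (reduction S G)) = through_arcs S (parcs (skel G))"
proof -
  let ?E = "parcs (skel G)"
  have "branches G S i j \<noteq> {} \<longleftrightarrow> (i, j) \<in> through_arcs S ?E" for i j
  proof (cases "i \<in> S \<and> j \<in> S")
    case True
    have "(\<exists>q \<in> exit_paths G S u. last q = j) \<longleftrightarrow> (u, j) \<in> (arcs_off S ?E)\<^sup>*" for u
    proof
      assume "\<exists>q \<in> exit_paths G S u. last q = j"
      then obtain q where q: "q \<in> exit_paths G S u" "last q = j" by blast
      have "fst e \<notin> S" if "e \<in> set (vwalk_arcs q)" for e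
        using q that fst_vwalk_arcs[of q] by (auto simp: exit_paths_def simp flip: fst_vwalk_arcs)
      then have "set (vwalk_arcs q) \<subseteq> arcs_off S ?E"
        using q by (force simp: exit_paths_def arcs_off_def)
      from path_imp_rtrancl[OF _ this, of j] q show "(u, j) \<in> (arcs_off S ?E)\<^sup>*"
        by (auto simp: exit_paths_def)
    next
      assume "(u, j) \<in> (arcs_off S ?E)\<^sup>*"
      from rtrancl_imp_path[OF this] obtain p where p: "p \<noteq> []" "hd p = u" "last p = j" "distinct p"
        "set (vwalk_arcs p) \<subseteq> arcs_off S ?E" by blast
      have "set (butlast p) \<inter> S = {}"
        using p(5) unfolding fst_vwalk_arcs[symmetric] by (force simp: arcs_off_def)
      with p True show "\<exists>q \<in> exit_paths G S u. last q = j"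
        by (intro bexI[of _ p]) (auto simp: exit_paths_def arcs_off_def)
    qed
    moreover have "hd q = u" if "q \<in> exit_paths G S u" for q u
      using that by (simp add: exit_paths_def)
    ultimately have step: "(\<exists>q. (i, hd q) \<in> ?E \<and> q \<in> exit_paths G S (hd q) \<and> last q = j) \<longleftrightarrow>
        (\<exists>u. (i, u) \<in> ?E \<and> (u, j) \<in> (arcs_off S ?E)\<^sup>*)"
      by metis
    have "branches G S i j \<noteq> {} \<longleftrightarrow>
        (\<exists>q. (i, hd q) \<in> ?E \<and> q \<in> exit_paths G S (hd q) \<and> last q = j)"
      using branches_eq[OF assms] True by auto
    with step True show ?thesis by (auto simp: through_arcs_def)
  next
    case False
    then show ?thesis by (auto simp: branches_def through_arcs_def)
  qed
  then show ?thesis by (auto simp: reduction_def)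
qed

lemma supported_reduction:
  assumes "supported G" and "S \<subseteq> pverts (skel G)"
  shows "supported (reduction S G)"
proof -
  have "finite S" using assms finite_subset by (auto simp: supported_def)
  moreover have "i \<in> S \<and> j \<in> S" if "branches G S i j \<noteq> {}" for i j
    using that by (auto simp: branches_def)
  ultimately show ?thesis by (auto simp: supported_def reduction_def)
qed

section \<open>Partial eigenvectors\<close>

abbreviation mult_weight :: "'a wdigraph \<Rightarrow> ('a \<Rightarrow> ratfun) \<Rightarrow> 'a \<Rightarrow> ratfun" where
  "mult_weight G x v \<equiv> (\<Sum>u\<in>pverts (skel G). weight G v u * x u)"

definition eigen_off :: "'a wdigraph \<Rightarrow> 'a set \<Rightarrow> ('a \<Rightarrow> ratfun) \<Rightarrow> bool" where
  "eigen_off G S x \<longleftrightarrow> (\<forall>v\<in>pverts (skel G) - S. mult_weight G x v = lam * x v)"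

text \<open>The Schur complement is described by its action on vectors, so that composing two of
  them involves no inverse matrices. Arcs have a clause of their own because weights do not reveal
  an arc of weight 0.\<close>

definition condenses :: "'a wdigraph \<Rightarrow> 'a set \<Rightarrow> 'a wdigraph \<Rightarrow> bool" where
  "condenses G S H \<longleftrightarrow> supported H \<and> pverts (skel H) = S \<and> S \<subseteq> pverts (skel G) \<and>
     parcs (skel H) = through_arcs S (parcs (skel G)) \<and>
     (\<forall>x. \<exists>x'. (\<forall>v\<in>S. x' v = x v) \<and> eigen_off G S x') \<and>
     (\<forall>x. eigen_off G S x \<longrightarrow> (\<forall>v\<in>S. mult_weight H x v = mult_weight G x v))"

lemma mult_weight_cong:
  "(\<And>u. u \<in> pverts (skel G) \<Longrightarrow> x u = y u) \<Longrightarrow> mult_weight G x v = mult_weight G y v"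
  by (rule sum.cong) auto

lemma condenses_extension:
  "condenses G S H \<Longrightarrow> \<exists>x'. (\<forall>v\<in>S. x' v = x v) \<and> eigen_off G S x'"
  by (simp add: condenses_def)

text \<open>A vector extends from \<open>T\<close> to \<open>S\<close> in \<open>H\<close> and then
  to all vertices in \<open>G\<close>; on \<open>S - T\<close> the equation for \<open>H\<close>
  becomes the one for \<open>G\<close> because both products agree there. Conversely, a solution off
  \<open>T\<close> in \<open>G\<close> is one off \<open>S\<close>, hence also one off
  \<open>T\<close> in \<open>H\<close>.\<close>

lemma condenses_trans:
  assumes GH: "condenses G S H" and HK: "condenses H T K"
  shows "condenses G T K"
proof -
  have sub: "T \<subseteq> S" "S \<subseteq> pverts (skel G)" and H: "pverts (skel H) = S"
    using assms by (auto simp: condenses_def)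
  have ext: "\<exists>x'. (\<forall>v\<in>T. x' v = x v) \<and> eigen_off G T x'" for x
  proof -
    obtain y where y: "\<forall>v\<in>T. y v = x v" "eigen_off H T y"
      using condenses_extension[OF HK] by blast
    obtain z where z: "\<forall>v\<in>S. z v = y v" "eigen_off G S z"
      using condenses_extension[OF GH] by blast
    have "mult_weight G z v = lam * z v" if v: "v \<in> pverts (skel G) - T" for v
    proof (cases "v \<in> S")
      case True
      then have "mult_weight G z v = mult_weight H z v"
        using GH z by (auto simp: condenses_def)
      \<comment> \<open>The product with the weights of \<open>H\<close> reads only values on
        \<open>S\<close>, where \<open>z\<close> and \<open>y\<close> agree.\<close>
      also have "\<dots> = mult_weight H y v"
        using z H by (intro mult_weight_cong) auto
      also have "\<dots> = lam * z v"
        using y z v True H by (auto simp: eigen_off_def)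
      finally show ?thesis .
    qed (use z v in \<open>auto simp: eigen_off_def\<close>)
    with y z sub show ?thesis by (intro exI[of _ z]) (auto simp: eigen_off_def)
  qed
  have "mult_weight K x v = mult_weight G x v" if x: "eigen_off G T x" and "v \<in> T" for x v
  proof -
    have "eigen_off G S x" using x sub by (auto simp: eigen_off_def)
    then have GHx: "mult_weight H x v = mult_weight G x v" if "v \<in> S" for v
      using that GH by (auto simp: condenses_def)
    then have "eigen_off H T x"
      using x sub H by (auto simp: eigen_off_def subset_eq)
    then have "mult_weight K x v = mult_weight H x v"
      using HK \<open>v \<in> T\<close> by (auto simp: condenses_def)
    with GHx sub \<open>v \<in> T\<close> show ?thesis by auto
  qed
  moreover have "parcs (skel K) = through_arcs T (parcs (skel G))"
    using GH HK through_arcs_trans[OF sub(1)] by (simp add: condenses_def)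
  ultimately show ?thesis
    using ext HK sub by (auto simp: condenses_def)
qed

text \<open>Extending the indicator of \<open>u\<close> gives one test vector for both graphs; each
  product with it is the entry in column \<open>u\<close>, and both equal the product with the
  weights of \<open>G\<close>.\<close>

lemma condenses_unique:
  fixes H K :: "'a wdigraph"
  assumes "condenses G S H" and "condenses G S K"
  shows "H = K"
proof -
  have skel: "pverts (skel H) = S" "pverts (skel K) = S" "parcs (skel H) = parcs (skel K)"
    using assms by (auto simp: condenses_def)
  have "weight H v u = weight K v u" for u v
  proof (cases "(v, u) \<in> parcs (skel H)")
    case True
    then have vu: "v \<in> S" "u \<in> S" and fin: "finite S"
      using assms by (auto simp: condenses_def supported_def)
    obtain x where x: "\<forall>w\<in>S. x w = (if w = u then 1 else 0)" "eigen_off G S x"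
      using condenses_extension[OF assms(1), of "\<lambda>w. if w = u then 1 else 0"] by blast
    have ind: "mult_weight L x v = weight L v u" if "pverts (skel L) = S" for L :: "'a wdigraph"
    proof -
      have "mult_weight L x v = (\<Sum>w\<in>S. if w = u then weight L v w else 0)"
        unfolding that using x by (intro sum.cong) auto
      then show ?thesis using vu fin by simp
    qed
    have "mult_weight H x v = mult_weight K x v"
      using assms x(2) vu(1) by (auto simp: condenses_def)
    then show ?thesis unfolding ind[OF skel(1)] ind[OF skel(2)] .
  next
    case False
    then show ?thesis using assms skel(3) by (auto simp: condenses_def supported_def)
  qed
  then have "weight H = weight K" by blast
  moreover have "skel H = skel K" using skel by simp
  ultimately show ?thesis by simp
qed

section \<open>A single reduction\<close>

lemma lam_minus_loop_nonzero:
  assumes "S \<in> st G" and "v \<in> pverts (skel G) - S"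
  shows "lam - weight G v v \<noteq> 0"
proof -
  have "weight G v v \<noteq> lam" using assms by (simp add: st_def)
  then show ?thesis by auto
qed

text \<open>The relational form of the cycle condition serves twice: prepending a vertex to an exit
  path keeps it simple, and induction along arcs off \<open>S\<close> is well-founded.\<close>

lemma acyclic_structural:
  assumes "supported G" and "S \<in> st G"
  shows "acyclic ((parcs (skel G) - Id) \<inter> (pverts (skel G) - S) \<times> (pverts (skel G) - S))"
    (is "acyclic ?r")
proof -
  let ?D = "with_proj (del_loops (skel G)) \<restriction> (pverts (skel G) - S)"
  have r: "arcs_ends ?D = ?r"
    by (auto simp: arcs_ends_conv del_loops_def induce_subgraph_def image_iff)
  have "acyclic (arcs_ends ?D)"
    by (rule acyclic_if_no_cycle) (use assms r in \<open>auto simp: st_def\<close>)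
  with r show ?thesis by simp
qed

text \<open>First-step decomposition. A path from a successor \<open>u\<close> that came back to
  \<open>v\<close> would close a cycle off \<open>S\<close>.\<close>

lemma exit_paths_unfold:
  assumes "supported G" and "S \<in> st G" and "v \<in> pverts (skel G) - S"
  shows "exit_paths G S v = (\<Union>u\<in>{u. (v, u) \<in> parcs (skel G) \<and> u \<noteq> v}. (#) v ` exit_paths G S u)"
    (is "_ = ?R")
proof (intro set_eqI iffI)
  fix p assume p: "p \<in> exit_paths G S v"
  then obtain q where q: "p = v # q" by (cases p) (auto simp: exit_paths_def)
  with p assms have "q \<noteq> []" by (auto simp: exit_paths_def)
  with p q show "p \<in> ?R" by (cases q) (auto simp: exit_paths_def image_iff)
next
  fix p assume "p \<in> ?R"
  then obtain u q where u: "(v, u) \<in> parcs (skel G)" "u \<noteq> v" and q: "q \<in> exit_paths G S u"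
    and p: "p = v # q" by blast
  let ?r = "(parcs (skel G) - Id) \<inter> (pverts (skel G) - S) \<times> (pverts (skel G) - S)"
  have ne: "q \<noteq> []" "hd q = u" "last q \<in> S" "distinct q" using q by (auto simp: exit_paths_def)
  have "v \<notin> set q"
  proof
    assume vq: "v \<in> set q"
    let ?b = "butlast q"
    have q_eq: "q = ?b @ [last q]" using ne by simp
    \<comment> \<open>Since \<open>v\<close> is off \<open>S\<close>, it is not the end of
      \<open>q\<close>; before its end \<open>q\<close> stays off \<open>S\<close> and, being
      distinct, uses no loops.\<close>
    have vb: "v \<in> set ?b"
      using vq ne assms(3) in_set_butlast_or_last by fastforce
    then have b: "?b \<noteq> []" by auto
    then have hb: "hd ?b = u" using ne(2) q_eq by (metis hd_append2)
    have "set (vwalk_arcs ?b) \<subseteq> ?r"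
    proof
      fix e assume e: "e \<in> set (vwalk_arcs ?b)"
      have "e \<in> set ?b \<times> set ?b" using e vwalk_arcs_subset by blast
      moreover have "e \<in> parcs (skel G)"
        using e q set_vwalk_arcs_append1[of ?b "[last q]"] q_eq by (auto simp: exit_paths_def)
      moreover have "e \<notin> Id"
      proof -
        have "distinct p \<Longrightarrow> (a, a) \<notin> set (vwalk_arcs p)" for a :: 'a and p
          by (induction p rule: vwalk_arcs.induct) (auto dest: subsetD[OF vwalk_arcs_subset])
        then show ?thesis using ne(4) distinct_butlast e by fastforce
      qed
      ultimately show "e \<in> ?r"
        using q assms(1) by (force simp: exit_paths_def supported_def)
    qed
    from path_imp_rtrancl[OF b this vb] have "(u, v) \<in> ?r\<^sup>*" by (simp only: hb)
    moreover have "(v, u) \<in> ?r"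
    proof -
      have "u \<in> set ?b" using b hb by (metis hd_in_set)
      then show ?thesis using u assms(1,3) q by (auto simp: exit_paths_def supported_def)
    qed
    ultimately have "(v, v) \<in> ?r\<^sup>+" by (rule rtrancl_into_trancl2[rotated])
    with acyclic_structural[OF assms(1,2)] show False by (auto simp: acyclic_def)
  qed
  then show "p \<in> exit_paths G S v"
    using q p u assms(3) by (auto simp: exit_paths_def)
qed

text \<open>For structural \<open>S\<close> this is the path expansion of the solution of the
  eigenvector equations off \<open>S\<close> with boundary values \<open>x\<close> on
  \<open>S\<close>.\<close>

definition exit_sum :: "'a wdigraph \<Rightarrow> 'a set \<Rightarrow> ('a \<Rightarrow> ratfun) \<Rightarrow> 'a \<Rightarrow> ratfun" where
  "exit_sum G S x v = (\<Sum>q\<in>exit_paths G S v. exit_product G q * x (last q))"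

lemma exit_sum_exit [simp]: "v \<in> S \<Longrightarrow> exit_sum G S x v = x v"
  by (simp add: exit_sum_def exit_paths_of_exit)

lemma sum_Cons_exit_paths:
  assumes "supported G" and "S \<subseteq> pverts (skel G)" and "finite N"
  shows "(\<Sum>p\<in>(\<Union>u\<in>N. (#) v ` exit_paths G S u). f p) = (\<Sum>u\<in>N. \<Sum>q\<in>exit_paths G S u. f (v # q))"
proof -
  have "(\<Sum>p\<in>(\<Union>u\<in>N. (#) v ` exit_paths G S u). f p) = (\<Sum>u\<in>N. \<Sum>p\<in>(#) v ` exit_paths G S u. f p)"
    using assms finite_exit_paths[OF assms(1,2)]
    by (intro sum.UNION_disjoint) (auto simp: exit_paths_def)
  then show ?thesis by (simp add: sum.reindex)
qed

text \<open>Splitting off the first step of each path leaves the loop factor of \<open>v\<close> as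
  a common denominator, which is nonzero.\<close>

lemma exit_sum_unfold:
  assumes "supported G" and "S \<in> st G" and v: "v \<in> pverts (skel G) - S"
  shows "(lam - weight G v v) * exit_sum G S x v =
    (\<Sum>u\<in>pverts (skel G) - {v}. weight G v u * exit_sum G S x u)"
proof -
  let ?N = "{u. (v, u) \<in> parcs (skel G) \<and> u \<noteq> v}"
  have S: "S \<subseteq> pverts (skel G)" using assms(2) by (simp add: st_def)
  have nz: "lam - weight G v v \<noteq> 0" using assms(2) v by (rule lam_minus_loop_nonzero)
  have N: "?N \<subseteq> pverts (skel G) - {v}" "finite (pverts (skel G) - {v})"
    using assms(1) by (auto simp: supported_def)
  then have "finite ?N" by (rule finite_subset)
  then have "exit_sum G S x v =
      (\<Sum>u\<in>?N. \<Sum>q\<in>exit_paths G S u. exit_product G (v # q) * x (last (v # q)))"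
    unfolding exit_sum_def exit_paths_unfold[OF assms] by (rule sum_Cons_exit_paths[OF assms(1) S])
  also have "\<dots> = (\<Sum>u\<in>?N. weight G v u / (lam - weight G v v) * exit_sum G S x u)"
    unfolding exit_sum_def sum_distrib_left
    by (intro sum.cong refl) (auto simp: exit_paths_def exit_product_Cons)
  finally have "(lam - weight G v v) * exit_sum G S x v = (\<Sum>u\<in>?N. weight G v u * exit_sum G S x u)"
    using nz by (simp add: sum_distrib_left)
  also have "\<dots> = (\<Sum>u\<in>pverts (skel G) - {v}. weight G v u * exit_sum G S x u)"
    using N assms(1) by (intro sum.mono_neutral_left) (auto simp: supported_def)
  finally show ?thesis .
qed

text \<open>Moving the loop term to the other side gives the equations the shape of the recursion
  for \<open>exit_sum\<close>.\<close>

lemma eigen_off_iff: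
  assumes "supported G"
  shows "eigen_off G S x \<longleftrightarrow> (\<forall>v\<in>pverts (skel G) - S.
    (lam - weight G v v) * x v = (\<Sum>u\<in>pverts (skel G) - {v}. weight G v u * x u))"
proof -
  have "mult_weight G x v = weight G v v * x v + (\<Sum>u\<in>pverts (skel G) - {v}. weight G v u * x u)"
    if "v \<in> pverts (skel G)" for v
    using that assms by (simp add: sum.remove supported_def)
  then show ?thesis by (auto simp: eigen_off_def algebra_simps)
qed

text \<open>Uniqueness of the extension: both sides obey the same recursion, and the finite acyclic
  graph off \<open>S\<close> allows induction from successors to \<open>v\<close>.\<close>

lemma eigen_off_eq_exit_sum:
  assumes G: "supported G" "S \<in> st G" and x: "eigen_off G S x" and "v \<in> pverts (skel G)"
  shows "x v = exit_sum G S x v"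
proof -
  let ?V = "pverts (skel G)"
  let ?r = "(parcs (skel G) - Id) \<inter> (?V - S) \<times> (?V - S)"
  have "finite ?r" using G(1) by (auto simp: supported_def)
  then have "wf (?r\<inverse>)" using acyclic_structural[OF G] by (rule finite_acyclic_wf_converse)
  then show ?thesis using \<open>v \<in> ?V\<close>
  proof (induction v)
    case (less v)
    show ?case
    proof (cases "v \<in> S")
      case False
      with less.prems have v: "v \<in> ?V - S" by simp
      \<comment> \<open>On \<open>S\<close> the boundary values agree, without an arc the weight is
        0, and for a successor off \<open>S\<close> the induction hypothesis applies.\<close>
      have "weight G v u * x u = weight G v u * exit_sum G S x u" if u: "u \<in> ?V - {v}" for u
      proof (cases "u \<in> S \<or> (v, u) \<notin> parcs (skel G)")
        case True
        then show ?thesis using G(1) by (auto simp: supported_def)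
      next
        case False
        then have "(u, v) \<in> ?r\<inverse>" using u v by auto
        then show ?thesis using less.IH u by simp
      qed
      then have "(\<Sum>u\<in>?V - {v}. weight G v u * x u) = (\<Sum>u\<in>?V - {v}. weight G v u * exit_sum G S x u)"
        by (rule sum.cong[OF refl])
      then have "(lam - weight G v v) * x v = (lam - weight G v v) * exit_sum G S x v"
        using x v unfolding eigen_off_iff[OF G(1)] exit_sum_unfold[OF G v] by simp
      moreover have "lam - weight G v v \<noteq> 0" using G(2) v by (rule lam_minus_loop_nonzero)
      ultimately show ?thesis by simp
    qed simp
  qed
qed

text \<open>The branches from \<open>i\<close> are grouped by their last vertex on the left and by
  their second vertex on the right.\<close>

lemma mult_weight_reduction:
  assumes G: "supported G" "S \<in> st G" and i: "i \<in> S"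
  shows "mult_weight (reduction S G) x i = mult_weight G (exit_sum G S x) i"
proof -
  let ?N = "{u. (i, u) \<in> parcs (skel G)}"
  have S: "S \<subseteq> pverts (skel G)" using G(2) by (simp add: st_def)
  have fin: "finite (pverts (skel G))" "finite S" and N: "?N \<subseteq> pverts (skel G)"
    using G(1) S finite_subset by (auto simp: supported_def)
  then have finN: "finite ?N" using finite_subset by blast
  have br: "(\<Union>j\<in>S. branches G S i j) = (\<Union>u\<in>?N. (#) i ` exit_paths G S u)"
    using branches_eq[OF G(1) S i] by (auto simp: exit_paths_def)
  have "finite (\<Union>u\<in>?N. (#) i ` exit_paths G S u)"
    using finN finite_exit_paths[OF G(1) S] by auto
  then have finb: "finite (branches G S i j)" if "j \<in> S" for j
    using that br by (metis UN_upper finite_subset)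
  have "mult_weight (reduction S G) x i =
      (\<Sum>j\<in>S. \<Sum>p\<in>branches G S i j. branch_product G p * x (last p))"
    by (auto simp: reduction_def sum_distrib_right branches_def intro!: sum.cong)
  also have "\<dots> = (\<Sum>p\<in>(\<Union>j\<in>S. branches G S i j). branch_product G p * x (last p))"
    using fin finb by (intro sum.UNION_disjoint[symmetric]) (auto simp: branches_def)
  also have "\<dots> = (\<Sum>u\<in>?N. \<Sum>q\<in>exit_paths G S u. branch_product G (i # q) * x (last (i # q)))"
    unfolding br by (rule sum_Cons_exit_paths[OF G(1) S finN])
  also have "\<dots> = (\<Sum>u\<in>?N. weight G i u * exit_sum G S x u)"
    unfolding exit_sum_def sum_distrib_left
    by (intro sum.cong refl) (auto simp: exit_paths_def branch_product_Cons)
  also have "\<dots> = mult_weight G (exit_sum G S x) i"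
    using N fin G(1) by (intro sum.mono_neutral_left) (auto simp: supported_def)
  finally show ?thesis .
qed

text \<open>Existence of the extension comes from \<open>exit_sum\<close>; its uniqueness replaces
  \<open>exit_sum G S x\<close> by \<open>x\<close> in the product.\<close>

lemma condenses_reduction:
  assumes G: "supported G" "S \<in> st G"
  shows "condenses G S (reduction S G)"
proof -
  have S: "S \<subseteq> pverts (skel G)" using G(2) by (simp add: st_def)
  have "eigen_off G S (exit_sum G S x)" for x
    using exit_sum_unfold[OF G] by (simp add: eigen_off_iff[OF G(1)])
  then have "\<exists>x'. (\<forall>v\<in>S. x' v = x v) \<and> eigen_off G S x'" for x
    by (intro exI[of _ "exit_sum G S x"]) simp
  moreover have "mult_weight (reduction S G) x v = mult_weight G x v"
    if "eigen_off G S x" "v \<in> S" for x v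
    unfolding mult_weight_reduction[OF G that(2)]
    using eigen_off_eq_exit_sum[OF G that(1)] by (intro mult_weight_cong) simp
  ultimately show ?thesis
    using supported_reduction[OF G(1) S] arcs_reduction[OF G(1) S] S
    unfolding condenses_def by (simp add: reduction_def)
qed

section \<open>Sequences of reductions\<close>

lemma condenses_reductions:
  assumes "supported G" and "induces_reductions G Ss"
  shows "condenses G (last Ss) (reductions G Ss)"
proof -
  have "Ss \<noteq> []" using assms(2) by (simp add: induces_reductions_def)
  then show ?thesis using assms(2)
  proof (induction Ss rule: rev_nonempty_induct)
    case (single S)
    then show ?case
      using condenses_reduction[OF assms(1)] by (simp add: induces_reductions_def reductions_def)
  next
    case (snoc S Ss)
    \<comment> \<open>Up to index \<open>length Ss\<close>, the prefixes of \<open>Ss @ [S]\<close>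
      are those of \<open>Ss\<close>.\<close>
    have "induces_reductions G Ss"
      unfolding induces_reductions_def
    proof (intro conjI allI impI)
      fix i assume "i < length Ss"
      then show "Ss ! i \<in> st (reductions G (take i Ss))"
        using snoc.prems unfolding induces_reductions_def
        by (auto simp: nth_append dest!: spec[of _ i])
    qed (use snoc.hyps in simp)
    then have IH: "condenses G (last Ss) (reductions G Ss)" by (rule snoc.IH)
    have "S \<in> st (reductions G Ss)"
      using snoc.prems unfolding induces_reductions_def by (auto dest!: spec[of _ "length Ss"])
    with IH have "condenses (reductions G Ss) S (reduction S (reductions G Ss))"
      by (intro condenses_reduction) (simp_all add: condenses_def)
    with IH have "condenses G S (reduction S (reductions G Ss))" by (rule condenses_trans)
    then show ?case by (simp add: reductions_def)
  qed
qed

theorem theorem3: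
  fixes G :: "'a wdigraph" and Ss Ts :: "'a set list"
  assumes "weighted_digraph_pi G"
    and "induces_reductions G Ss"
    and "induces_reductions G Ts"
    and "last Ss = last Ts"
  shows "reductions G Ss = reductions G Ts"
proof -
  have G: "pair_fin_digraph (skel G)" "\<forall>u v. weight G u v = 0 \<longleftrightarrow> (u, v) \<notin> parcs (skel G)"
    using assms(1) by (auto simp: weighted_digraph_pi_def weighted_digraph_def)
  interpret pair_fin_digraph "skel G" by (rule G)
  have "supported G"
    using G(2) finite_verts in_arcsD1 in_arcsD2 by (auto simp: supported_def)
  \<comment> \<open>Both results condense \<open>G\<close> onto the same last set, and only one
    graph does.\<close>
  then show ?thesis
    using condenses_reductions assms(2-4) condenses_unique by metis
qed

end
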